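(* Let $L\ge1$ and let $\boldsymbol{G}_1,\dots,\boldsymbol{G}_L\in\mathbb{R}^{2\times2}$ be symmetric positive definite matrices. Let $\gamma$ be the Riemannian-like metric anisotropic surface energy $$\gamma(\boldsymbol{n})=\sum_{l=1}^L\gamma_l(\boldsymbol{n}),\qquad\gamma_l(\boldsymbol{n})=\sqrt{\boldsymbol{n}^T\boldsymbol{G}_l\boldsymbol{n}},\qquad\boldsymbol{n}\in\mathbb{S}^1 .$$ Then the minimal stabilizing function $k_0$ of $\gamma$ satisfies $k_0(\boldsymbol{n})\le k_1(\boldsymbol{n})$, where $$k_1(\boldsymbol{n})=\sum_{l=1}^L\gamma_l(\boldsymbol{n})^{-1}\mathrm{Tr}(\boldsymbol{G}_l),\qquad \boldsymbol{Z}_{k_1}(\boldsymbol{n})=\sum_{l=1}^L\gamma_l(\boldsymbol{n})^{-1}\boldsymbol{J}^T\boldsymbol{G}_l\boldsymbol{J},\qquad\forall\boldsymbol{n}\in\mathbb{S}^1,$$ with $\boldsymbol{J}=\begin{pmatrix}0&-1\\1&0\end{pmatrix}$, and $k_0(\boldsymbol{n})=k_1(\boldsymbol{n})$ if $L=1$.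
   Context: $\mathbb{S}^1\subset\mathbb{R}^2$ is the unit circle and $^\perp$ denotes clockwise rotation by $\pi/2$, i.e. $(a,b)^\perp=(b,-a)$. A function $\gamma:\mathbb{S}^1\to(0,\infty)$ is extended by $\gamma(\boldsymbol{p})=|\boldsymbol{p}|\gamma(\boldsymbol{p}/|\boldsymbol{p}|)$ for $\boldsymbol{p}\ne\boldsymbol{0}$, $\gamma(\boldsymbol{0})=0$; $\boldsymbol{\xi}(\boldsymbol{n})=\nabla\gamma(\boldsymbol{p})|_{\boldsymbol{p}=\boldsymbol{n}}$. For $k:\mathbb{S}^1\to(0,\infty)$, the surface energy matrix is $$\boldsymbol{Z}_k(\boldsymbol{n})=\gamma(\boldsymbol{n})I_2-\boldsymbol{n}\boldsymbol{\xi}(\boldsymbol{n})^T-\boldsymbol{\xi}(\boldsymbol{n})\boldsymbol{n}^T+k(\boldsymbol{n})\boldsymbol{n}\boldsymbol{n}^T .$$ For $\hat{\boldsymbol{n}}\ne\pm\boldsymbol{n}$ in $\mathbb{S}^1$, $$F(\boldsymbol{n},\hat{\boldsymbol{n}})=\frac{\gamma(\hat{\boldsymbol{n}})^2-\gamma(\boldsymbol{n})^2+2\gamma(\boldsymbol{n})(\boldsymbol{\xi}(\boldsymbol{n})\cdot\hat{\boldsymbol{n}}^\perp)(\boldsymbol{n}\cdot\hat{\boldsymbol{n}}^\perp)}{\gamma(\boldsymbol{n})(\boldsymbol{n}\cdot\hat{\boldsymbol{n}}^\perp)^2},$$ extended to $\hat{\boldsymbol{n}}=\boldsymbol{n}$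 by its limit as $\hat{\boldsymbol{n}}\to\boldsymbol{n}$ in $\mathbb{S}^1$. The minimal stabilizing function is $k_0(\boldsymbol{n})=\max\{F(\boldsymbol{n},\hat{\boldsymbol{n}}):\hat{\boldsymbol{n}}\in\mathbb{S}^1,\ \hat{\boldsymbol{n}}\cdot\boldsymbol{n}\ge0\}$. *)

theory Defs
  imports "HOL-Analysis.Analysis"
begin

(* The unit circle is sphere 0 1 in real^2.  Functions on the circle are total functions
   real^2 => real of which only the values on the circle are ever used. *)

(* clockwise rotation by pi/2 *)
definition perp :: "real^2 \<Rightarrow> real^2" where
  "perp v = vector [v $ 2, - (v $ 1)]"

definition hom_ext :: "(real^2 \<Rightarrow> real) \<Rightarrow> real^2 \<Rightarrow> real" where
  "hom_ext \<gamma> p = (if p = 0 then 0 else norm p * \<gamma> (p /\<^sub>R norm p))"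

definition xi :: "(real^2 \<Rightarrow> real) \<Rightarrow> real^2 \<Rightarrow> real^2" where
  "xi \<gamma> n = (THE D. GDERIV (hom_ext \<gamma>) n :> D)"

definition outer :: "real^2 \<Rightarrow> real^2 \<Rightarrow> real^2^2" where
  "outer u v = (columnvector u :: real^1^2) ** (rowvector v :: real^2^1)"

definition surface_energy_matrix ::
    "(real^2 \<Rightarrow> real) \<Rightarrow> (real^2 \<Rightarrow> real) \<Rightarrow> real^2 \<Rightarrow> real^2^2" where
  "surface_energy_matrix \<gamma> k n =
     \<gamma> n *\<^sub>R mat 1 - outer n (xi \<gamma> n) - outer (xi \<gamma> n) n + k n *\<^sub>R outer n n"

(* The denominator vanishes on the circle exactly at m = n and m = - n (given \<gamma> n \<noteq> 0). *)
definition F_quot :: "(real^2 \<Rightarrow> real) \<Rightarrow> real^2 \<Rightarrow> real^2 \<Rightarrow> real" where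
  "F_quot \<gamma> n m =
     ((\<gamma> m)\<^sup>2 - (\<gamma> n)\<^sup>2 + 2 * \<gamma> n * (xi \<gamma> n \<bullet> perp m) * (n \<bullet> perp m)) /
     (\<gamma> n * (n \<bullet> perp m)\<^sup>2)"

definition F :: "(real^2 \<Rightarrow> real) \<Rightarrow> real^2 \<Rightarrow> real^2 \<Rightarrow> real" where
  "F \<gamma> n m =
     (if m = n then Lim (at n within sphere 0 1) (F_quot \<gamma> n) else F_quot \<gamma> n m)"

(* Greatest is a genuine (attained) maximum, not a supremum; it is unspecified if there is
   no maximum. *)
definition min_stab :: "(real^2 \<Rightarrow> real) \<Rightarrow> real^2 \<Rightarrow> real" where
  "min_stab \<gamma> n = (GREATEST y. y \<in> {F \<gamma> n m | m. m \<in> sphere 0 1 \<and> m \<bullet> n \<ge> 0})"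

definition sym_pos_def :: "real^'n^'n \<Rightarrow> bool" where
  "sym_pos_def G \<longleftrightarrow> transpose G = G \<and> (\<forall>x. x \<noteq> 0 \<longrightarrow> x \<bullet> (G *v x) > 0)"

definition metric_energy :: "real^2^2 \<Rightarrow> real^2 \<Rightarrow> real" where
  "metric_energy G n = sqrt (n \<bullet> (G *v n))"

definition riemannian_energy :: "nat \<Rightarrow> (nat \<Rightarrow> real^2^2) \<Rightarrow> real^2 \<Rightarrow> real" where
  "riemannian_energy L G n = (\<Sum>l=1..L. metric_energy (G l) n)"

definition k1 :: "nat \<Rightarrow> (nat \<Rightarrow> real^2^2) \<Rightarrow> real^2 \<Rightarrow> real" where
  "k1 L G n = (\<Sum>l=1..L. inverse (metric_energy (G l) n) * trace (G l))"

definition J :: "real^2^2" where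
  "J = vector [vector [0, -1], vector [1, 0]]"

end

(* With g_l = gamma_l(n), h_l = gamma_l(m) and s = n . perp m, the trace identity
     s^2 Tr(G_l) = h_l^2 - g_l^2 + 2 s (G_l n . perp m)
   shows that k_1(n) - F(n, m) is, up to the factor 1 / (s^2 sum g_l), the Cauchy-Schwarz defect
     (sum g_l) (sum h_l^2 / g_l) - (sum h_l)^2
       = 1/2 sum_{i,j} (h_i g_j - h_j g_i)^2 / (g_i g_j) >= 0,
   which is zero for L = 1. Multiplying by the conjugate h_i g_j + h_j g_i shows that
   h_i g_j - h_j g_i is divisible by s, so F(n, .) extends continuously to m = n and the maximum
   over the half circle is attained. *)

theory Submission
  imports Defs
begin

section \<open>Planar coordinates and the energy of a single metric\<close>

lemma perp_nth [simp]: "perp v $ 1 = v $ 2" "perp v $ 2 = - (v $ 1)"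
  by (simp_all add: perp_def)

lemma inner_vec2: "u \<bullet> v = u $ 1 * v $ 1 + u $ 2 * v $ 2" for u v :: "real^2"
  by (simp add: inner_vec_def sum_2)

lemma norm_1_vec2: "norm n = 1 \<longleftrightarrow> (n $ 1)\<^sup>2 + (n $ 2)\<^sup>2 = 1" for n :: "real^2"
  by (simp add: norm_eq_1 inner_vec2 power2_eq_square)

lemma matrix_vector_nth_2: "((A :: real^2^2) *v x) $ i = A $ i $ 1 * x $ 1 + A $ i $ 2 * x $ 2"
  by (simp add: matrix_vector_mult_def sum_2)

lemma outer_nth: "outer u v $ i $ j = u $ i * v $ j"
  by (simp add: outer_def matrix_matrix_mult_def columnvector_def rowvector_def)

lemma sym_pos_def_sym: "sym_pos_def G \<Longrightarrow> G $ i $ j = G $ j $ i"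
  unfolding sym_pos_def_def by (auto simp: transpose_def vec_eq_iff)

lemma sym_pos_def_inner:
  assumes "sym_pos_def G"
  shows "(x :: real^2) \<bullet> (G *v y) = y \<bullet> (G *v x)"
  by (simp add: inner_vec_def matrix_vector_mult_def sum_2 sym_pos_def_sym [OF assms, of 2 1] algebra_simps)

lemma metric_energy_power2:
  assumes "sym_pos_def G"
  shows "(metric_energy G x)\<^sup>2 = x \<bullet> (G *v x)"
proof -
  have "x \<bullet> (G *v x) \<ge> 0"
    using assms by (cases "x = 0") (auto simp: sym_pos_def_def intro: less_imp_le)
  thus ?thesis
    by (simp add: metric_energy_def)
qed

lemma metric_energy_pos:
  assumes "sym_pos_def G" "x \<noteq> 0"
  shows "metric_energy G x > 0"
  using assms unfolding metric_energy_def sym_pos_def_def by simp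

lemma metric_energy_scaleR: "metric_energy G (r *\<^sub>R x) = \<bar>r\<bar> * metric_energy G x"
proof -
  have "(r *\<^sub>R x) \<bullet> (G *v (r *\<^sub>R x)) = r\<^sup>2 * (x \<bullet> (G *v x))"
    by (simp add: matrix_vector_mult_scaleR power2_eq_square)
  thus ?thesis
    by (simp add: metric_energy_def real_sqrt_mult)
qed

lemma continuous_on_metric_energy [continuous_intros]: "continuous_on S (metric_energy G)"
  unfolding metric_energy_def by (intro continuous_on_real_sqrt continuous_on_inner continuous_on_id
      matrix_vector_mult_linear_continuous_on)

section \<open>Homogeneous extension and gradient\<close>

text \<open>The square-root formula is already positively homogeneous of degree one on the whole
  plane, so \<open>xi\<close> can be computed by differentiating it directly.\<close>

lemma hom_ext_riemannian: "hom_ext (riemannian_energy L G) = riemannian_energy L G"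
proof
  fix p show "hom_ext (riemannian_energy L G) p = riemannian_energy L G p"
    by (cases "p = 0") (simp_all add: hom_ext_def riemannian_energy_def metric_energy_scaleR
      metric_energy_def [where n = 0] flip: sum_distrib_left mult.assoc)
qed

lemma has_derivative_metric_energy:
  assumes "sym_pos_def G" "n \<noteq> 0"
  shows "(metric_energy G has_derivative
           (\<lambda>h. h \<bullet> (inverse (metric_energy G n) *\<^sub>R (G *v n)))) (at n)"
proof -
  have pos: "n \<bullet> (G *v n) > 0"
    using assms by (simp add: sym_pos_def_def)
  have "((\<lambda>x. x \<bullet> (G *v x)) has_derivative (\<lambda>h. n \<bullet> (G *v h) + h \<bullet> (G *v n))) (at n)"
    by (rule has_derivative_inner [OF has_derivative_ident
        bounded_linear.has_derivative [OF matrix_vector_mul_bounded_linear has_derivative_ident]])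
  moreover have "n \<bullet> (G *v h) = h \<bullet> (G *v n)" for h
    by (rule sym_pos_def_inner [OF assms(1)])
  ultimately have "((\<lambda>x. x \<bullet> (G *v x)) has_derivative (\<lambda>h. 2 * (h \<bullet> (G *v n)))) (at n)"
    by simp
  from has_derivative_real_sqrt [OF pos this]
  show ?thesis
    unfolding metric_energy_def
    by (rule has_derivative_eq_rhs) (simp add: fun_eq_iff field_simps)
qed

lemma xi_riemannian:
  assumes "\<And>l. l \<in> {1..L} \<Longrightarrow> sym_pos_def (G l)" "n \<noteq> 0"
  shows "xi (riemannian_energy L G) n =
           (\<Sum>l=1..L. inverse (metric_energy (G l) n) *\<^sub>R (G l *v n))" (is "_ = ?D")
proof -
  have "(riemannian_energy L G has_derivative
      (\<lambda>h. \<Sum>l=1..L. h \<bullet> (inverse (metric_energy (G l) n) *\<^sub>R (G l *v n)))) (at n)"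
    unfolding riemannian_energy_def
    using assms by (intro has_derivative_sum has_derivative_metric_energy)
  hence D: "GDERIV (riemannian_energy L G) n :> ?D"
    by (simp add: gderiv_def inner_sum_right)
  \<comment> \<open>\<open>xi\<close> is a definite description, so the gradient must also be shown
    to be unique.\<close>
  have "D' = ?D" if "GDERIV (riemannian_energy L G) n :> D'" for D'
  proof -
    have "(\<lambda>h. h \<bullet> D') = (\<lambda>h. h \<bullet> ?D)"
      using that D unfolding gderiv_def by (rule has_derivative_unique)
    thus ?thesis by (simp only: fun_eq_iff vector_eq_ldot)
  qed
  with D show ?thesis
    unfolding xi_def hom_ext_riemannian by (rule the_equality)
qed

section \<open>The surface energy matrix for \<open>k1\<close>\<close>

text \<open>This is the case of one metric, multiplied by its energy to clear the square root. The
  right-hand side is the adjugate of \<open>G\<close>.\<close>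

lemma surface_energy_matrix_single:
  assumes "sym_pos_def G" "norm n = 1"
  shows "(n \<bullet> (G *v n)) *\<^sub>R mat 1 - outer n (G *v n) - outer (G *v n) n + trace G *\<^sub>R outer n n
         = transpose J ** G ** J"
proof -
  have s: "G $ 2 $ 1 = G $ 1 $ 2"
    by (rule sym_pos_def_sym [OF assms(1)])
  define a b where "a = n $ 1" and "b = n $ 2"
  have unit: "a\<^sup>2 + b\<^sup>2 = 1"
    using assms(2) by (simp add: norm_1_vec2 a_def b_def)
  define p q r where "p = G $ 1 $ 1" and "q = G $ 1 $ 2" and "r = G $ 2 $ 2"
  define A where "A = n \<bullet> (G *v n)"
  have A: "A = p * a\<^sup>2 + 2 * q * a * b + r * b\<^sup>2"
    by (simp add: A_def a_def b_def p_def q_def r_def inner_vec2 matrix_vector_nth_2 s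
        algebra_simps power2_eq_square)
  \<comment> \<open>The four entries in the order (1,1), (2,2), (1,2), (2,1), as polynomial
    identities; \<open>unit\<close> later removes the factor \<open>a^2 + b^2\<close>.\<close>
  have "A - a * (p * a + q * b) - (p * a + q * b) * a + (p + r) * (a * a) = r * (a\<^sup>2 + b\<^sup>2)"
       "A - b * (q * a + r * b) - (q * a + r * b) * b + (p + r) * (b * b) = p * (a\<^sup>2 + b\<^sup>2)"
       "- (a * (q * a + r * b)) - (p * a + q * b) * b + (p + r) * (a * b) = - q * (a\<^sup>2 + b\<^sup>2)"
       "- (b * (p * a + q * b)) - (q * a + r * b) * a + (p + r) * (b * a) = - q * (a\<^sup>2 + b\<^sup>2)"
    unfolding A by (simp_all add: algebra_simps power2_eq_square)
  thus ?thesis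
    unfolding vec_eq_iff forall_2 J_def unit A_def [symmetric]
    by (simp add: matrix_vector_nth_2 outer_nth trace_def sum_2 mat_def
        matrix_matrix_mult_def transpose_def s flip: a_def b_def p_def q_def r_def)
qed

text \<open>Energy, gradient and \<open>k1\<close> are all sums over \<open>l\<close>, so the
  single-metric identities add up with weights \<open>1 / metric_energy (G l) n\<close>.\<close>

lemma surface_energy_matrix_riemannian:
  assumes "\<And>l. l \<in> {1..L} \<Longrightarrow> sym_pos_def (G l)" "norm n = 1"
  shows "surface_energy_matrix (riemannian_energy L G) (k1 L G) n =
           (\<Sum>l=1..L. inverse (metric_energy (G l) n) *\<^sub>R (transpose J ** G l ** J))"
proof -
  have n0: "n \<noteq> 0" using assms(2) by auto
  have xi: "xi (riemannian_energy L G) n =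
      (\<Sum>l=1..L. inverse (metric_energy (G l) n) *\<^sub>R (G l *v n))"
    using n0 assms(1) by (intro xi_riemannian)
  have "(\<Sum>l=1..L. inverse (metric_energy (G l) n) *\<^sub>R (transpose J ** G l ** J)) =
    (\<Sum>l=1..L. inverse (metric_energy (G l) n) *\<^sub>R ((metric_energy (G l) n)\<^sup>2 *\<^sub>R mat 1
       - outer n (G l *v n) - outer (G l *v n) n + trace (G l) *\<^sub>R outer n n))"
    using assms by (intro sum.cong) (auto simp: surface_energy_matrix_single metric_energy_power2)
  also have "\<dots> = (\<Sum>l=1..L. metric_energy (G l) n *\<^sub>R mat 1
       - outer n (inverse (metric_energy (G l) n) *\<^sub>R (G l *v n))
       - outer (inverse (metric_energy (G l) n) *\<^sub>R (G l *v n)) n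
       + (inverse (metric_energy (G l) n) * trace (G l)) *\<^sub>R outer n n)"
    using metric_energy_pos [OF assms(1) n0]
    by (intro sum.cong) (auto simp: vec_eq_iff outer_nth field_simps power2_eq_square)
  also have "\<dots> = surface_energy_matrix (riemannian_energy L G) (k1 L G) n"
    unfolding surface_energy_matrix_def xi unfolding riemannian_energy_def k1_def
    by (simp add: vec_eq_iff outer_nth sum.distrib sum_subtractf sum_distrib_left sum_distrib_right)
  finally show ?thesis ..
qed

section \<open>Quadratic forms in the basis given by a point of the circle\<close>

lemma inner_perp: "n \<bullet> perp m = - (perp n \<bullet> m)"
  by (simp add: inner_vec2)

text \<open>On the unit circle, \<open>m \<bullet> n\<close> and \<open>n \<bullet> perp m\<close> are the coordinates of \<open>m\<close> in the
  orthonormal basis \<open>n, - perp n\<close>.\<close>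

lemma inner_perp_squares:
  assumes "norm n = 1" "norm m = 1"
  shows "(m \<bullet> n)\<^sup>2 + (n \<bullet> perp m)\<^sup>2 = 1"
proof -
  have "(m \<bullet> n)\<^sup>2 + (n \<bullet> perp m)\<^sup>2 = ((n $ 1)\<^sup>2 + (n $ 2)\<^sup>2) * ((m $ 1)\<^sup>2 + (m $ 2)\<^sup>2)"
    by (simp add: inner_vec2 algebra_simps power2_eq_square)
  thus ?thesis
    using assms by (simp add: norm_1_vec2)
qed

text \<open>The vanishing sine leaves only \<open>n\<close> and \<open>- n\<close>; the half-circle
  condition excludes the latter.\<close>

lemma inner_perp_eq_0:
  assumes "norm n = 1" "norm m = 1" "m \<bullet> n \<ge> 0" "n \<bullet> perp m = 0"
  shows "m = n"
proof -
  have "(m \<bullet> n)\<^sup>2 = 1"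
    using inner_perp_squares [OF assms(1,2)] assms(4) by simp
  hence "m \<bullet> n = 1"
    using assms(3) by (simp add: power2_eq_1_iff)
  hence "norm (m - n) ^ 2 = 0"
    using assms(1,2) by (simp add: power2_norm_eq_inner inner_diff algebra_simps norm_eq_1 inner_commute)
  thus ?thesis by simp
qed

text \<open>Substitute \<open>m = (m \<bullet> n) n - (n \<bullet> perp m) perp n\<close> and expand
  by symmetry of \<open>G\<close>.\<close>

lemma quad_form_expand:
  assumes "sym_pos_def G" "norm n = 1"
  shows "m \<bullet> (G *v m) = (m \<bullet> n)\<^sup>2 * (n \<bullet> (G *v n)) - 2 * (m \<bullet> n) * (n \<bullet> perp m) * (perp n \<bullet> (G *v n))
           + (n \<bullet> perp m)\<^sup>2 * (perp n \<bullet> (G *v perp n))"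
proof -
  have s: "G $ 2 $ 1 = G $ 1 $ 2"
    by (rule sym_pos_def_sym [OF assms(1)])
  have n: "(n $ 1)\<^sup>2 + (n $ 2)\<^sup>2 = 1"
    using assms(2) by (simp add: norm_1_vec2)
  \<comment> \<open>The power of \<open>|n|\<close> makes both sides homogeneous of degree 4 in
    \<open>n\<close>, so that the identity is purely polynomial.\<close>
  have "((n $ 1)\<^sup>2 + (n $ 2)\<^sup>2)\<^sup>2 * (m \<bullet> (G *v m)) =
      (m \<bullet> n)\<^sup>2 * (n \<bullet> (G *v n)) - 2 * (m \<bullet> n) * (n \<bullet> perp m) * (perp n \<bullet> (G *v n))
        + (n \<bullet> perp m)\<^sup>2 * (perp n \<bullet> (G *v perp n))"
    unfolding inner_vec2 matrix_vector_nth_2 perp_nth s by algebra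
  thus ?thesis
    unfolding n by simp
qed

text \<open>Made homogeneous with \<open>|n|^2\<close> and \<open>|m|^2\<close>, this is a
  polynomial identity. For a single metric it says that \<open>F_quot\<close> is constantly the
  trace divided by the energy at \<open>n\<close>.\<close>

lemma trace_quad_form:
  assumes "norm n = 1" "norm m = 1" "sym_pos_def G"
  shows "(n \<bullet> perp m)\<^sup>2 * trace G =
     m \<bullet> (G *v m) - n \<bullet> (G *v n) + 2 * ((G *v n) \<bullet> perp m) * (n \<bullet> perp m)"
proof -
  have s: "G $ 2 $ 1 = G $ 1 $ 2"
    by (rule sym_pos_def_sym [OF assms(3)])
  have n: "(n $ 1)\<^sup>2 + (n $ 2)\<^sup>2 = 1" "(m $ 1)\<^sup>2 + (m $ 2)\<^sup>2 = 1"
    using assms by (simp_all add: norm_1_vec2)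
  have "(n \<bullet> perp m)\<^sup>2 * trace G =
      (m \<bullet> (G *v m)) * ((n $ 1)\<^sup>2 + (n $ 2)\<^sup>2) - (n \<bullet> (G *v n)) * ((m $ 1)\<^sup>2 + (m $ 2)\<^sup>2)
        + 2 * ((G *v n) \<bullet> perp m) * (n \<bullet> perp m)"
    unfolding inner_vec2 matrix_vector_nth_2 perp_nth s trace_def sum_2 by algebra
  thus ?thesis
    unfolding n by simp
qed

section \<open>The Cauchy-Schwarz defect and its factor of the squared sine\<close>

text \<open>For positive \<open>g\<close>, this is Lagrange's identity for the vectors with entries
  \<open>sqrt (g i)\<close> and \<open>h i / sqrt (g i)\<close>. The double sum runs over ordered
  pairs, hence the factor 2.\<close>

lemma Cauchy_Schwarz_defect:
  fixes g h :: "'a \<Rightarrow> real"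
  assumes "\<And>i. i \<in> I \<Longrightarrow> g i \<noteq> 0"
  shows "(\<Sum>i\<in>I. \<Sum>j\<in>I. (h i * g j - h j * g i)\<^sup>2 / (g i * g j)) =
           2 * (sum g I * (\<Sum>i\<in>I. (h i)\<^sup>2 / g i) - (sum h I)\<^sup>2)"
proof -
  have "(\<Sum>i\<in>I. \<Sum>j\<in>I. (h i * g j - h j * g i)\<^sup>2 / (g i * g j)) =
     (\<Sum>i\<in>I. \<Sum>j\<in>I. (h i)\<^sup>2 / g i * g j + g i * ((h j)\<^sup>2 / g j) - 2 * (h i * h j))"
    using assms by (intro sum.cong refl) (simp add: field_simps power2_eq_square)
  also have "\<dots> = 2 * (sum g I * (\<Sum>i\<in>I. (h i)\<^sup>2 / g i) - (sum h I)\<^sup>2)"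
  proof -
    have "(\<Sum>i\<in>I. \<Sum>j\<in>I. (h i)\<^sup>2 / g i * g j) = (\<Sum>i\<in>I. (h i)\<^sup>2 / g i) * sum g I"
         "(\<Sum>i\<in>I. \<Sum>j\<in>I. g i * ((h j)\<^sup>2 / g j)) = sum g I * (\<Sum>i\<in>I. (h i)\<^sup>2 / g i)"
      by (simp_all only: sum_product)
    moreover have "(\<Sum>i\<in>I. \<Sum>j\<in>I. 2 * (h i * h j)) = 2 * (sum h I)\<^sup>2"
      unfolding power2_eq_square sum_product by (simp only: sum_distrib_left)
    ultimately show ?thesis
      unfolding sum.distrib sum_subtractf by simp
  qed
  finally show ?thesis .
qed

text \<open>The quotient by \<open>n \<bullet> perp m\<close> of the difference of squares in
  \<open>slope_eq\<close>, written out as a polynomial so that it keeps its meaning at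
  \<open>m = n\<close>.\<close>

definition slope_num :: "real^2^2 \<Rightarrow> real^2^2 \<Rightarrow> real^2 \<Rightarrow> real^2 \<Rightarrow> real" where
  "slope_num A B n m =
     (n \<bullet> perp m) * ((perp n \<bullet> (A *v perp n)) * (n \<bullet> (B *v n)) - (perp n \<bullet> (B *v perp n)) * (n \<bullet> (A *v n)))
     - 2 * (m \<bullet> n) * ((perp n \<bullet> (A *v n)) * (n \<bullet> (B *v n)) - (perp n \<bullet> (B *v n)) * (n \<bullet> (A *v n)))"

definition slope :: "real^2^2 \<Rightarrow> real^2^2 \<Rightarrow> real^2 \<Rightarrow> real^2 \<Rightarrow> real" where
  "slope A B n m = slope_num A B n m /
     (metric_energy A m * metric_energy B n + metric_energy B m * metric_energy A n)"

lemma slope_denom_pos: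
  assumes "sym_pos_def A" "sym_pos_def B" "norm n = 1" "norm m = 1"
  shows "metric_energy A m * metric_energy B n + metric_energy B m * metric_energy A n > 0"
proof -
  have "n \<noteq> 0" "m \<noteq> 0" using assms(3,4) by auto
  thus ?thesis
    using assms(1,2) by (intro add_pos_pos mult_pos_pos metric_energy_pos)
qed

text \<open>The conjugate factor replaces square roots by quadratic forms. After
  \<open>quad_form_expand\<close> the terms with \<open>(m \<bullet> n)^2\<close> cancel, and every
  remaining term contains \<open>n \<bullet> perp m\<close>.\<close>

lemma slope_eq:
  assumes "sym_pos_def A" "sym_pos_def B" "norm n = 1" "norm m = 1"
  shows "metric_energy A m * metric_energy B n - metric_energy B m * metric_energy A n =
           (n \<bullet> perp m) * slope A B n m"
proof -
  have "(metric_energy A m * metric_energy B n - metric_energy B m * metric_energy A n) *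
        (metric_energy A m * metric_energy B n + metric_energy B m * metric_energy A n) =
        (metric_energy A m)\<^sup>2 * (metric_energy B n)\<^sup>2 - (metric_energy B m)\<^sup>2 * (metric_energy A n)\<^sup>2"
    by algebra
  also have "\<dots> = (n \<bullet> perp m) * slope_num A B n m"
    unfolding metric_energy_power2 [OF assms(1)] metric_energy_power2 [OF assms(2)]
      quad_form_expand [OF assms(1,3), of m] quad_form_expand [OF assms(2,3), of m] slope_num_def
    by algebra
  finally show ?thesis
    using slope_denom_pos [OF assms] by (simp add: slope_def eq_divide_eq)
qed

lemma continuous_on_slope:
  assumes "sym_pos_def A" "sym_pos_def B" "norm n = 1"
  shows "continuous_on (sphere 0 1) (slope A B n)"
  \<comment> \<open>Moving \<open>perp\<close> onto the fixed \<open>n\<close> leaves only inner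
    products of \<open>m\<close> with constants, which the continuity rules handle.\<close>
  unfolding slope_def slope_num_def inner_perp [of n]
proof (rule continuous_on_divide)
  show "\<forall>m\<in>sphere 0 1. metric_energy A m * metric_energy B n + metric_energy B m * metric_energy A n \<noteq> 0"
    using slope_denom_pos [OF assms] by (metis less_irrefl mem_sphere_0)
qed (intro continuous_intros)+

section \<open>The continuous extension of the quotient\<close>

text \<open>The denominator in \<open>slope\<close> does not vanish on the circle, so this is the continuous
  extension of \<open>F_quot\<close> to the whole circle.\<close>

definition F_reg :: "nat \<Rightarrow> (nat \<Rightarrow> real^2^2) \<Rightarrow> real^2 \<Rightarrow> real^2 \<Rightarrow> real" where
  "F_reg L G n m = k1 L G n - (\<Sum>i=1..L. \<Sum>j=1..L. (slope (G i) (G j) n m)\<^sup>2 /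
     (metric_energy (G i) n * metric_energy (G j) n)) / (2 * riemannian_energy L G n)"

lemma continuous_on_F_reg:
  assumes "\<And>l. l \<in> {1..L} \<Longrightarrow> sym_pos_def (G l)" "norm n = 1"
  shows "continuous_on (sphere 0 1) (F_reg L G n)"
  unfolding F_reg_def divide_inverse
  by (intro continuous_on_diff continuous_on_mult continuous_on_sum continuous_on_power
      continuous_on_const continuous_on_slope assms)

lemma riemannian_energy_pos:
  assumes "L \<ge> 1" "\<And>l. l \<in> {1..L} \<Longrightarrow> sym_pos_def (G l)" "n \<noteq> 0"
  shows "riemannian_energy L G n > 0"
  unfolding riemannian_energy_def
  using assms by (intro sum_pos metric_energy_pos) auto

text \<open>What is subtracted from \<open>k1\<close> is a sum of squares with nonnegative
  weights.\<close>

lemma F_reg_le_k1: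
  assumes "\<And>l. l \<in> {1..L} \<Longrightarrow> sym_pos_def (G l)" "n \<noteq> 0"
  shows "F_reg L G n m \<le> k1 L G n"
proof -
  have "metric_energy (G l) n \<ge> 0" if "l \<in> {1..L}" for l
    using metric_energy_pos [OF assms(1) [OF that] assms(2)] by simp
  thus ?thesis
    unfolding F_reg_def riemannian_energy_def
    by (auto intro!: divide_nonneg_nonneg sum_nonneg mult_nonneg_nonneg)
qed

text \<open>The only pair is \<open>i = j\<close>, and \<open>slope_num\<close> is antisymmetric in
  its two matrices.\<close>

lemma F_reg_single: "F_reg (Suc 0) G n m = k1 (Suc 0) G n"
  by (simp add: F_reg_def slope_def slope_num_def)

text \<open>The weighted trace identities turn the numerator into \<open>sum g * s^2 * k1\<close>
  minus the Cauchy-Schwarz defect. By \<open>slope_eq\<close> the defect also contains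
  \<open>s^2\<close>, which then cancels.\<close>

lemma F_quot_eq_F_reg:
  assumes "L \<ge> 1" "\<And>l. l \<in> {1..L} \<Longrightarrow> sym_pos_def (G l)" "norm n = 1" "norm m = 1"
    and s0: "n \<bullet> perp m \<noteq> 0"
  shows "F_quot (riemannian_energy L G) n m = F_reg L G n m"
proof -
  have n0: "n \<noteq> 0" using assms(3) by auto
  let ?I = "{1..L}"
  define s where "s = n \<bullet> perp m"
  define g where "g l = metric_energy (G l) n" for l
  define h where "h l = metric_energy (G l) m" for l
  have g_pos: "g l > 0" if "l \<in> ?I" for l
    unfolding g_def by (rule metric_energy_pos [OF assms(2) [OF that] n0])
  have Gpos: "sum g ?I > 0"
    using riemannian_energy_pos [OF assms(1,2) n0] by (simp add: riemannian_energy_def g_def)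
  define T where "T = xi (riemannian_energy L G) n \<bullet> perp m"
  have T: "T = (\<Sum>l\<in>?I. ((G l *v n) \<bullet> perp m) / g l)"
    using assms(2) n0 unfolding T_def
    by (subst xi_riemannian) (simp_all add: g_def inner_sum_left divide_inverse mult.commute)
  \<comment> \<open>Divide \<open>trace_quad_form\<close> for each \<open>l\<close> by
    \<open>g l\<close> and sum; the inner products collect into \<open>T\<close>.\<close>
  have tr: "s\<^sup>2 * k1 L G n = (\<Sum>l\<in>?I. (h l)\<^sup>2 / g l) - sum g ?I + 2 * T * s"
  proof -
    have "s\<^sup>2 * k1 L G n = (\<Sum>l\<in>?I. (s\<^sup>2 * trace (G l)) / g l)"
      by (simp add: k1_def g_def sum_distrib_left field_simps)
    also have "\<dots> = (\<Sum>l\<in>?I. (h l)\<^sup>2 / g l - g l + 2 * (((G l *v n) \<bullet> perp m) / g l) * s)"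
    proof (intro sum.cong refl)
      fix l assume l: "l \<in> ?I"
      have "s\<^sup>2 * trace (G l) = (h l)\<^sup>2 - (g l)\<^sup>2 + 2 * ((G l *v n) \<bullet> perp m) * s"
        unfolding s_def g_def h_def metric_energy_power2 [OF assms(2) [OF l]]
        by (rule trace_quad_form [OF assms(3,4) assms(2) [OF l]])
      thus "s\<^sup>2 * trace (G l) / g l = (h l)\<^sup>2 / g l - g l + 2 * (((G l *v n) \<bullet> perp m) / g l) * s"
        using g_pos [OF l] by (simp add: add_divide_distrib diff_divide_distrib power2_eq_square)
    qed
    finally show ?thesis
      by (simp add: T sum.distrib sum_subtractf sum_distrib_left sum_distrib_right)
  qed
  have "2 * (sum g ?I * (\<Sum>i\<in>?I. (h i)\<^sup>2 / g i) - (sum h ?I)\<^sup>2) =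
      (\<Sum>i\<in>?I. \<Sum>j\<in>?I. (h i * g j - h j * g i)\<^sup>2 / (g i * g j))"
    using g_pos by (intro Cauchy_Schwarz_defect [symmetric]) force
  also have "\<dots> = (\<Sum>i\<in>?I. \<Sum>j\<in>?I. s\<^sup>2 * ((slope (G i) (G j) n m)\<^sup>2 / (g i * g j)))"
    using assms by (intro sum.cong refl) (simp add: g_def h_def s_def slope_eq power_mult_distrib)
  also have "\<dots> = s\<^sup>2 * (\<Sum>i\<in>?I. \<Sum>j\<in>?I. (slope (G i) (G j) n m)\<^sup>2 / (g i * g j))" (is "_ = _ * ?W")
    by (simp add: sum_distrib_left)
  finally have cs: "2 * (sum g ?I * (\<Sum>i\<in>?I. (h i)\<^sup>2 / g i) - (sum h ?I)\<^sup>2) = s\<^sup>2 * ?W" .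
  have num: "(sum h ?I)\<^sup>2 - (sum g ?I)\<^sup>2 + 2 * sum g ?I * T * s =
      sum g ?I * s\<^sup>2 * (k1 L G n - ?W / (2 * sum g ?I))"
  proof -
    have "2 * (sum g ?I * s\<^sup>2 * (k1 L G n - ?W / (2 * sum g ?I)))
        = 2 * sum g ?I * (s\<^sup>2 * k1 L G n) - s\<^sup>2 * ?W"
      using Gpos by (simp add: field_simps)
    also have "\<dots> = 2 * ((sum h ?I)\<^sup>2 - (sum g ?I)\<^sup>2 + 2 * sum g ?I * T * s)"
      unfolding tr cs [symmetric] by (simp add: algebra_simps power2_eq_square)
    finally show ?thesis by simp
  qed
  have "F_quot (riemannian_energy L G) n m =
      ((sum h ?I)\<^sup>2 - (sum g ?I)\<^sup>2 + 2 * sum g ?I * T * s) / (sum g ?I * s\<^sup>2)"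
    by (simp add: F_quot_def riemannian_energy_def T_def g_def h_def s_def)
  also have "\<dots> = k1 L G n - ?W / (2 * sum g ?I)"
    unfolding num using Gpos s0 by (simp add: s_def)
  finally show ?thesis
    by (simp add: F_reg_def riemannian_energy_def g_def)
qed

text \<open>At \<open>m = n\<close> the value of \<open>F\<close> is a limit of
  \<open>F_quot\<close>, which agrees with the continuous \<open>F_reg\<close> at nearby points of
  the circle.\<close>

lemma F_eq_F_reg:
  assumes "L \<ge> 1" "\<And>l. l \<in> {1..L} \<Longrightarrow> sym_pos_def (G l)" "norm n = 1" "norm m = 1" "m \<bullet> n \<ge> 0"
  shows "F (riemannian_energy L G) n m = F_reg L G n m"
proof (cases "m = n")
  case False
  hence "n \<bullet> perp m \<noteq> 0"
    using inner_perp_eq_0 assms by blast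
  with False show ?thesis
    using F_quot_eq_F_reg [OF assms(1,2,3,4)] by (simp add: F_def)
next
  case True
  \<comment> \<open>Keeps \<open>x\<close> away from \<open>- n\<close>, so that
    \<open>inner_perp_eq_0\<close> yields a nonzero denominator.\<close>
  have "eventually (\<lambda>x. x \<bullet> n > 0) (at n within sphere 0 1)"
  proof (rule order_tendstoD(1))
    show "((\<lambda>x. x \<bullet> n) \<longlongrightarrow> n \<bullet> n) (at n within sphere 0 1)"
      by (intro tendsto_intros)
  qed (use assms(3) in \<open>simp add: norm_eq_1\<close>)
  moreover have "eventually (\<lambda>x. x \<noteq> n \<and> x \<in> sphere 0 1) (at n within sphere 0 1)"
    by (simp add: eventually_at_filter)
  ultimately have "eventually (\<lambda>x. F_reg L G n x = F_quot (riemannian_energy L G) n x) (at n within sphere 0 1)"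
  proof eventually_elim
    case (elim x)
    hence "norm x = 1" "n \<bullet> perp x \<noteq> 0"
      using inner_perp_eq_0 [OF assms(3), of x] by auto
    thus ?case
      using F_quot_eq_F_reg [OF assms(1,2,3)] by simp
  qed
  moreover have "(F_reg L G n \<longlongrightarrow> F_reg L G n n) (at n within sphere 0 1)"
    using continuous_on_F_reg [OF assms(2,3)] assms(3) unfolding continuous_on_def by simp
  ultimately have "(F_quot (riemannian_energy L G) n \<longlongrightarrow> F_reg L G n n) (at n within sphere 0 1)"
    by (rule Lim_transform_eventually [rotated])
  \<comment> \<open>\<open>Lim\<close> is determined only if \<open>n\<close> is not isolated: the
    circle is connected and contains both \<open>n\<close> and \<open>- n\<close>.\<close>
  moreover have "\<not> trivial_limit (at n within sphere 0 1)"
  proof -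
    have "sphere 0 1 \<noteq> {x}" for x :: "real^2"
    proof
      assume "sphere 0 1 = {x}"
      moreover have "n \<in> sphere 0 1" "- n \<in> sphere 0 1"
        using assms(3) by simp_all
      ultimately have "- n = n" by (metis singletonD)
      hence "n = 0" by (simp add: vec_eq_iff)
      thus False using assms(3) by simp
    qed
    thus ?thesis
      unfolding trivial_limit_within
      using connected_imp_perfect [of "sphere 0 1" n] connected_sphere [of "0 :: real^2" 1] assms(3) by simp
  qed
  ultimately show ?thesis
    using True by (simp add: F_def tendsto_Lim)
qed

section \<open>Attainment of the maximum and conclusion\<close>

text \<open>\<open>GREATEST\<close> is meaningful once a maximum exists, which the extreme value
  theorem provides.\<close>

lemma Greatest_image_compact:
  fixes f :: "'a::topological_space \<Rightarrow> real"
  assumes "compact S" "S \<noteq> {}" "continuous_on S f"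
  shows "(GREATEST y. y \<in> f ` S) \<in> f ` S"
proof -
  obtain x where "x \<in> S" "\<And>y. y \<in> S \<Longrightarrow> f y \<le> f x"
    using continuous_attains_sup [OF assms] by blast
  moreover from this have "(GREATEST y. y \<in> f ` S) = f x"
    by (intro Greatest_equality) auto
  ultimately show ?thesis by simp
qed

text \<open>Knowing some \<open>m\<close> suffices, since the bound by \<open>k1\<close>, and
  equality when \<open>L = 1\<close>, hold for \<open>F_reg\<close> at every
  \<open>m\<close>.\<close>

lemma min_stab_in_F_reg:
  assumes "L \<ge> 1" "\<And>l. l \<in> {1..L} \<Longrightarrow> sym_pos_def (G l)" "norm n = 1"
  shows "\<exists>m. min_stab (riemannian_energy L G) n = F_reg L G n m"
proof -
  let ?S = "sphere 0 1 \<inter> {m. m \<bullet> n \<ge> 0}"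
  have im: "{F (riemannian_energy L G) n m |m. m \<in> sphere 0 1 \<and> m \<bullet> n \<ge> 0} = F_reg L G n ` ?S"
  proof -
    have "{F (riemannian_energy L G) n m |m. m \<in> sphere 0 1 \<and> m \<bullet> n \<ge> 0} =
        F (riemannian_energy L G) n ` ?S"
      by blast
    also have "\<dots> = F_reg L G n ` ?S"
      by (intro image_cong refl F_eq_F_reg [OF assms]) auto
    finally show ?thesis .
  qed
  have "compact ?S"
    by (intro compact_Int_closed compact_sphere closed_Collect_le continuous_intros)
  moreover have "?S \<noteq> {}"
    using assms(3) by (auto intro!: exI [of _ n])
  moreover have "continuous_on ?S (F_reg L G n)"
    using continuous_on_F_reg [OF assms(2,3)] by (rule continuous_on_subset) auto
  ultimately have "min_stab (riemannian_energy L G) n \<in> F_reg L G n ` ?S"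
    unfolding min_stab_def im by (rule Greatest_image_compact)
  thus ?thesis by blast
qed

theorem lemma4p7:
  fixes L :: nat and G :: "nat \<Rightarrow> real^2^2"
  assumes "L \<ge> 1"
    and "\<And>l. l \<in> {1..L} \<Longrightarrow> sym_pos_def (G l)"
  shows "\<forall>n \<in> sphere 0 1.
           min_stab (riemannian_energy L G) n \<le> k1 L G n \<and>
           surface_energy_matrix (riemannian_energy L G) (k1 L G) n =
             (\<Sum>l=1..L. inverse (metric_energy (G l) n) *\<^sub>R (transpose J ** G l ** J)) \<and>
           (L = 1 \<longrightarrow> min_stab (riemannian_energy L G) n = k1 L G n)"
proof
  fix n :: "real^2" assume "n \<in> sphere 0 1"
  hence n: "norm n = 1" "n \<noteq> 0" by auto
  obtain m where m: "min_stab (riemannian_energy L G) n = F_reg L G n m"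
    using min_stab_in_F_reg [of L G n] assms n(1) by auto
  show "min_stab (riemannian_energy L G) n \<le> k1 L G n \<and>
        surface_energy_matrix (riemannian_energy L G) (k1 L G) n =
          (\<Sum>l=1..L. inverse (metric_energy (G l) n) *\<^sub>R (transpose J ** G l ** J)) \<and>
        (L = 1 \<longrightarrow> min_stab (riemannian_energy L G) n = k1 L G n)"
    unfolding m
    using F_reg_le_k1 [OF assms(2) n(2)] surface_energy_matrix_riemannian [OF assms(2) n(1)]
    by (auto simp: F_reg_single)
qed

end
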